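(* Let $\Lambda$ be an $S$-sorted set of formulas and $\mathbf K\Lambda$ the normal modal logic it defines. For any $s\in S$ and $\phi\in Form_s$ the following are equivalent: (i) $\vdash^s_{\mathbf K\Lambda}\phi$; (ii) $[\phi]_{\mathbf K\Lambda}=[\top_s]_{\mathbf K\Lambda}$ in the Lindenbaum-Tarski algebra $\mathfrak L_{\mathbf K\Lambda}$; (iii) $\mathfrak e_s(\phi)=1_s$ in $A_s$ for every $(S,\Sigma)$-BAO $\mathfrak A$ with $\mathbf K\Lambda\subseteq Taut(\mathfrak A)$ and every assignment $e$ in $\mathfrak A$.
   Context: Let $(S,\Sigma)$ be a many-sorted signature (each $\sigma\in\Sigma$ has a type $s_1\ldots s_n\to s$, $n\ge0$; $\Sigma_{s_1\ldots s_n,s}$ the symbols of that type; $[n]=\{1,\ldots,n\}$), and $P=\{P_s\}_{s\in S}$ nonempty pairwise disjoint sets of propositional variables. Formulas $Form_s$: $P_s\subseteq Form_s$, closure under $\neg,\vee$ within a sort, and $\sigma(\phi_1,\ldots,\phi_n)\in Form_s$ for $\sigma\in\Sigma_{s_1\ldots s_n,s}$, $\phi_i\in Form_{s_i}$. Abbreviations: $\wedge,\to,\leftrightarrow$; $\bot_s:=p\wedge\neg p$ for fixed $p\in P_s$; $\top_s:=\neg\bot_s$; for $n\ge1$, $\sigma^\Box(\phi_1,\ldots,\phi_n):=\neg\sigma(\neg\phi_1,\ldots,\neg\phi_n)$. $\mathbf K=\{\mathbf K_s\}$: the least $S$-sorted set containing in each sort all classical propositional theorems and, for $n\ge1$, $\sigma\in\Sigma_{s_1\ldots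 s_n,s}$, $i\in[n]$, $\psi_j\in Form_{s_j}$, $\phi,\chi\in Form_{s_i}$, the axioms $\sigma^\Box(\ldots,\phi\to\chi,\ldots)\to(\sigma^\Box(\ldots,\phi,\ldots)\to\sigma^\Box(\ldots,\chi,\ldots))$ (position $i$, other arguments $\psi_j$) and $\sigma(\psi_1,\ldots,\psi_n)\leftrightarrow\neg\sigma^\Box(\neg\psi_1,\ldots,\neg\psi_n)$. $\mathbf K\Lambda_s$ is $\mathbf K_s$ plus all sort-preserving uniform substitution instances of formulas in $\Lambda_s$. Rules: modus ponens within a sort; universal generalization (from $\phi\in Form_{s_i}$ infer $\sigma^\Box(\psi_1,\ldots,\psi_{i-1},\phi,\psi_{i+1},\ldots,\psi_n)$, $n\ge1$). $\vdash^s_{\mathbf K\Lambda}\phi$: $\phi\in Form_s$ has a finite proof from $\mathbf K\Lambda$ by these rules. An $(S,\Sigma)$-BAO is $\mathfrak A=(\{\mathcal A_s\}_{s\in S},\{f_\sigma\}_{\sigma\in\Sigma})$, each $\mathcal A_s=(A_s,\vee_s,\neg_s,0_s)$ a boolean algebra (top $1_s$), $f_\sigma:A_{s_1}\times\cdots\times A_{s_n}\to A_s$ for $\sigma\in\Sigma_{s_1\ldots s_n,s}$ satisfying $f_\sigma(\ldots,0_{s_i},\ldots)=0_s$ and additivity in each argument. An assignment is $e=\{e_s\}$, $e_s:P_s\to A_s$; it extends uniquely to $\mathfrak e$ on formulas by $\mathfrak e(\neg\phi)=\neg\mathfrak e(\phi)$, $\mathfrak e(\phi\vee\psi)=\mathfrak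 e(\phi)\vee\mathfrak e(\psi)$, $\mathfrak e(\sigma(\phi_1,\ldots,\phi_n))=f_\sigma(\mathfrak e(\phi_1),\ldots,\mathfrak e(\phi_n))$. $Taut(\mathfrak A)_s=\{\phi\in Form_s\mid \mathfrak e_s(\phi)=1_s$ for every assignment $e\}$; $\mathbf K\Lambda\subseteq Taut(\mathfrak A)$ means $\mathbf K\Lambda_s\subseteq Taut(\mathfrak A)_s$ for all $s$. Lindenbaum-Tarski algebra $\mathfrak L_{\mathbf K\Lambda}$: on each $Form_s$, $\phi\equiv^s\psi$ iff $\vdash^s_{\mathbf K\Lambda}\phi\leftrightarrow\psi$; $\mathfrak L_{\mathbf K\Lambda}$ has carriers $Form_s/\equiv^s$ with classes $[\phi]_{\mathbf K\Lambda}$, induced boolean operations ($0_s=[\bot_s]$), and operators $\tilde f_\sigma([\phi_1],\ldots,[\phi_n])=[\sigma(\phi_1,\ldots,\phi_n)]$. *)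

theory Defs
  imports Main
begin

section \<open>Many-sorted languages and formulas\<close>

text \<open>The type of \<open>\<sigma>\<close> is \<open>arity \<sigma> \<rightarrow> result \<sigma>\<close>; \<open>botvar s\<close> is
  the variable fixed once and for all in the definition of the falsum of sort \<open>s\<close>.
  Sorts and operation symbols are sets, so that either may be empty.\<close>

record ('s, 'o, 'p) lang =
  Sorts :: "'s set"
  Ops :: "'o set"
  arity :: "'o \<Rightarrow> 's list"
  result :: "'o \<Rightarrow> 's"
  Vars :: "'s \<Rightarrow> 'p set"
  botvar :: "'s \<Rightarrow> 'p"

definition many_sorted_lang :: "('s, 'o, 'p) lang \<Rightarrow> bool" where
  "many_sorted_lang L \<longleftrightarrow>
     (\<forall>\<sigma> \<in> Ops L. set (arity L \<sigma>) \<subseteq> Sorts L \<and> result L \<sigma> \<in> Sorts L) \<and>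
     (\<forall>s \<in> Sorts L. Vars L s \<noteq> {}) \<and>
     (\<forall>s \<in> Sorts L. \<forall>t \<in> Sorts L. s \<noteq> t \<longrightarrow> Vars L s \<inter> Vars L t = {}) \<and>
     (\<forall>s \<in> Sorts L. botvar L s \<in> Vars L s)"

datatype ('o, 'p) fm =
    Var 'p
  | Neg "('o, 'p) fm"
  | Or "('o, 'p) fm" "('o, 'p) fm"
  | Op 'o "('o, 'p) fm list"

inductive is_form :: "('s, 'o, 'p) lang \<Rightarrow> 's \<Rightarrow> ('o, 'p) fm \<Rightarrow> bool" for L where
  "s \<in> Sorts L \<Longrightarrow> p \<in> Vars L s \<Longrightarrow> is_form L s (Var p)"
| "is_form L s \<phi> \<Longrightarrow> is_form L s (Neg \<phi>)"
| "is_form L s \<phi> \<Longrightarrow> is_form L s \<psi> \<Longrightarrow> is_form L s (Or \<phi> \<psi>)"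
| "\<sigma> \<in> Ops L \<Longrightarrow> list_all2 (is_form L) (arity L \<sigma>) \<phi>s \<Longrightarrow> is_form L (result L \<sigma>) (Op \<sigma> \<phi>s)"

definition Form :: "('s, 'o, 'p) lang \<Rightarrow> 's \<Rightarrow> ('o, 'p) fm set" where
  "Form L s = {\<phi>. is_form L s \<phi>}"

definition And :: "('o, 'p) fm \<Rightarrow> ('o, 'p) fm \<Rightarrow> ('o, 'p) fm" where
  "And \<phi> \<psi> = Neg (Or (Neg \<phi>) (Neg \<psi>))"

definition Imp :: "('o, 'p) fm \<Rightarrow> ('o, 'p) fm \<Rightarrow> ('o, 'p) fm" where
  "Imp \<phi> \<psi> = Or (Neg \<phi>) \<psi>"

definition Iff :: "('o, 'p) fm \<Rightarrow> ('o, 'p) fm \<Rightarrow> ('o, 'p) fm" where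
  "Iff \<phi> \<psi> = And (Imp \<phi> \<psi>) (Imp \<psi> \<phi>)"

definition Bot :: "('s, 'o, 'p) lang \<Rightarrow> 's \<Rightarrow> ('o, 'p) fm" where
  "Bot L s = And (Var (botvar L s)) (Neg (Var (botvar L s)))"

definition Top :: "('s, 'o, 'p) lang \<Rightarrow> 's \<Rightarrow> ('o, 'p) fm" where
  "Top L s = Neg (Bot L s)"

definition Box :: "'o \<Rightarrow> ('o, 'p) fm list \<Rightarrow> ('o, 'p) fm" where
  "Box \<sigma> \<phi>s = Neg (Op \<sigma> (map Neg \<phi>s))"


section \<open>The logic\<close>

text \<open>Classical propositional theorems of a sort are its truth-table tautologies, where variables
  and formulas \<open>\<sigma>(\<phi>\<^sub>1, \<dots>, \<phi>\<^sub>n)\<close> count as atoms.\<close>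

primrec truth :: "(('o, 'p) fm \<Rightarrow> bool) \<Rightarrow> ('o, 'p) fm \<Rightarrow> bool" where
  "truth v (Var p) = v (Var p)"
| "truth v (Neg \<phi>) = (\<not> truth v \<phi>)"
| "truth v (Or \<phi> \<psi>) = (truth v \<phi> \<or> truth v \<psi>)"
| "truth v (Op \<sigma> \<phi>s) = v (Op \<sigma> \<phi>s)"

definition classical_theorem :: "('o, 'p) fm \<Rightarrow> bool" where
  "classical_theorem \<phi> \<longleftrightarrow> (\<forall>v. truth v \<phi>)"

text \<open>Positions are counted from 0; \<open>\<psi>s[i := \<phi>]\<close> puts \<open>\<phi>\<close> at position \<open>i\<close>.\<close>

inductive K_axiom :: "('s, 'o, 'p) lang \<Rightarrow> 's \<Rightarrow> ('o, 'p) fm \<Rightarrow> bool" for L where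
  classical: "\<phi> \<in> Form L s \<Longrightarrow> classical_theorem \<phi> \<Longrightarrow> K_axiom L s \<phi>"
| normality: "\<sigma> \<in> Ops L \<Longrightarrow> i < length (arity L \<sigma>) \<Longrightarrow>
    list_all2 (\<lambda>t \<psi>. \<psi> \<in> Form L t) (arity L \<sigma>) \<psi>s \<Longrightarrow>
    \<phi> \<in> Form L (arity L \<sigma> ! i) \<Longrightarrow> \<chi> \<in> Form L (arity L \<sigma> ! i) \<Longrightarrow>
    K_axiom L (result L \<sigma>)
      (Imp (Box \<sigma> (\<psi>s[i := Imp \<phi> \<chi>])) (Imp (Box \<sigma> (\<psi>s[i := \<phi>])) (Box \<sigma> (\<psi>s[i := \<chi>]))))"
| duality: "\<sigma> \<in> Ops L \<Longrightarrow> arity L \<sigma> \<noteq> [] \<Longrightarrow>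
    list_all2 (\<lambda>t \<psi>. \<psi> \<in> Form L t) (arity L \<sigma>) \<psi>s \<Longrightarrow>
    K_axiom L (result L \<sigma>) (Iff (Op \<sigma> \<psi>s) (Neg (Box \<sigma> (map Neg \<psi>s))))"

primrec subst :: "('p \<Rightarrow> ('o, 'p) fm) \<Rightarrow> ('o, 'p) fm \<Rightarrow> ('o, 'p) fm" where
  "subst \<theta> (Var p) = \<theta> p"
| "subst \<theta> (Neg \<phi>) = Neg (subst \<theta> \<phi>)"
| "subst \<theta> (Or \<phi> \<psi>) = Or (subst \<theta> \<phi>) (subst \<theta> \<psi>)"
| "subst \<theta> (Op \<sigma> \<phi>s) = Op \<sigma> (map (subst \<theta>) \<phi>s)"

definition sort_preserving :: "('s, 'o, 'p) lang \<Rightarrow> ('p \<Rightarrow> ('o, 'p) fm) \<Rightarrow> bool" where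
  "sort_preserving L \<theta> \<longleftrightarrow> (\<forall>s \<in> Sorts L. \<forall>p \<in> Vars L s. \<theta> p \<in> Form L s)"

definition K :: "('s, 'o, 'p) lang \<Rightarrow> ('s \<Rightarrow> ('o, 'p) fm set) \<Rightarrow> 's \<Rightarrow> ('o, 'p) fm set" where
  "K L \<Lambda> s = {\<phi>. K_axiom L s \<phi>} \<union> {subst \<theta> \<phi> | \<theta> \<phi>. sort_preserving L \<theta> \<and> \<phi> \<in> \<Lambda> s}"

inductive provable ::
  "('s, 'o, 'p) lang \<Rightarrow> ('s \<Rightarrow> ('o, 'p) fm set) \<Rightarrow> 's \<Rightarrow> ('o, 'p) fm \<Rightarrow> bool" for L \<Lambda> where
  ax: "s \<in> Sorts L \<Longrightarrow> \<phi> \<in> K L \<Lambda> s \<Longrightarrow> provable L \<Lambda> s \<phi>"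
| mp: "provable L \<Lambda> s \<phi> \<Longrightarrow> provable L \<Lambda> s (Imp \<phi> \<psi>) \<Longrightarrow> provable L \<Lambda> s \<psi>"
| ug: "\<sigma> \<in> Ops L \<Longrightarrow> i < length (arity L \<sigma>) \<Longrightarrow>
    list_all2 (\<lambda>t \<psi>. \<psi> \<in> Form L t) (arity L \<sigma>) \<psi>s \<Longrightarrow>
    provable L \<Lambda> (arity L \<sigma> ! i) \<phi> \<Longrightarrow>
    provable L \<Lambda> (result L \<sigma>) (Box \<sigma> (\<psi>s[i := \<phi>]))"


section \<open>Many-sorted boolean algebras with operators\<close>

record ('s, 'o, 'a) bao =
  car :: "'s \<Rightarrow> 'a set"
  bjoin :: "'s \<Rightarrow> 'a \<Rightarrow> 'a \<Rightarrow> 'a"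
  bneg :: "'s \<Rightarrow> 'a \<Rightarrow> 'a"
  bzero :: "'s \<Rightarrow> 'a"
  opn :: "'o \<Rightarrow> 'a list \<Rightarrow> 'a"

definition bone :: "('s, 'o, 'a) bao \<Rightarrow> 's \<Rightarrow> 'a" where
  "bone \<AA> s = bneg \<AA> s (bzero \<AA> s)"

text \<open>Boolean algebras \<open>(A, \<or>, \<not>, 0)\<close> on a carrier set, with meet and top as derived operations;
  the one-element algebra is allowed (it is the Lindenbaum-Tarski algebra of an inconsistent
  sort).\<close>

definition boolean_algebra_on ::
  "'a set \<Rightarrow> ('a \<Rightarrow> 'a \<Rightarrow> 'a) \<Rightarrow> ('a \<Rightarrow> 'a) \<Rightarrow> 'a \<Rightarrow> bool" where
  "boolean_algebra_on A join neg zero \<longleftrightarrow>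
     (let meet = (\<lambda>x y. neg (join (neg x) (neg y))); one = neg zero in
       zero \<in> A \<and> (\<forall>x \<in> A. neg x \<in> A) \<and> (\<forall>x \<in> A. \<forall>y \<in> A. join x y \<in> A) \<and>
       (\<forall>x \<in> A. \<forall>y \<in> A. join x y = join y x \<and> meet x y = meet y x) \<and>
       (\<forall>x \<in> A. \<forall>y \<in> A. \<forall>z \<in> A.
          join x (join y z) = join (join x y) z \<and> meet x (meet y z) = meet (meet x y) z) \<and>
       (\<forall>x \<in> A. join x zero = x \<and> meet x one = x) \<and>
       (\<forall>x \<in> A. join x (neg x) = one \<and> meet x (neg x) = zero) \<and>
       (\<forall>x \<in> A. \<forall>y \<in> A. \<forall>z \<in> A.
          join x (meet y z) = meet (join x y) (join x z) \<and>
          meet x (join y z) = join (meet x y) (meet x z)))"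

definition is_bao :: "('s, 'o, 'p) lang \<Rightarrow> ('s, 'o, 'a) bao \<Rightarrow> bool" where
  "is_bao L \<AA> \<longleftrightarrow>
     (\<forall>s \<in> Sorts L. boolean_algebra_on (car \<AA> s) (bjoin \<AA> s) (bneg \<AA> s) (bzero \<AA> s)) \<and>
     (\<forall>\<sigma> \<in> Ops L. \<forall>as. list_all2 (\<lambda>t a. a \<in> car \<AA> t) (arity L \<sigma>) as \<longrightarrow>
        opn \<AA> \<sigma> as \<in> car \<AA> (result L \<sigma>) \<and>
        (\<forall>i < length (arity L \<sigma>).
           opn \<AA> \<sigma> (as[i := bzero \<AA> (arity L \<sigma> ! i)]) = bzero \<AA> (result L \<sigma>) \<and>
           (\<forall>x \<in> car \<AA> (arity L \<sigma> ! i). \<forall>y \<in> car \<AA> (arity L \<sigma> ! i).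
              opn \<AA> \<sigma> (as[i := bjoin \<AA> (arity L \<sigma> ! i) x y]) =
              bjoin \<AA> (result L \<sigma>) (opn \<AA> \<sigma> (as[i := x])) (opn \<AA> \<sigma> (as[i := y])))))"

definition is_assignment ::
  "('s, 'o, 'p) lang \<Rightarrow> ('s, 'o, 'a) bao \<Rightarrow> ('s \<Rightarrow> 'p \<Rightarrow> 'a) \<Rightarrow> bool" where
  "is_assignment L \<AA> e \<longleftrightarrow> (\<forall>s \<in> Sorts L. \<forall>p \<in> Vars L s. e s p \<in> car \<AA> s)"

function (sequential) interp ::
  "('s, 'o, 'p) lang \<Rightarrow> ('s, 'o, 'a) bao \<Rightarrow> ('s \<Rightarrow> 'p \<Rightarrow> 'a) \<Rightarrow> 's \<Rightarrow> ('o, 'p) fm \<Rightarrow> 'a" where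
  "interp L \<AA> e s (Var p) = e s p"
| "interp L \<AA> e s (Neg \<phi>) = bneg \<AA> s (interp L \<AA> e s \<phi>)"
| "interp L \<AA> e s (Or \<phi> \<psi>) = bjoin \<AA> s (interp L \<AA> e s \<phi>) (interp L \<AA> e s \<psi>)"
| "interp L \<AA> e s (Op \<sigma> \<phi>s) = opn \<AA> \<sigma> (map2 (interp L \<AA> e) (arity L \<sigma>) \<phi>s)"
  by pat_completeness auto
termination
  by (relation "measure (\<lambda>(_, _, _, _, \<phi>). size \<phi>)")
    (auto dest!: set_zip_rightD simp: less_Suc_eq_le intro: size_list_estimation')

definition Taut :: "('s, 'o, 'p) lang \<Rightarrow> ('s, 'o, 'a) bao \<Rightarrow> 's \<Rightarrow> ('o, 'p) fm set" where
  "Taut L \<AA> s = {\<phi> \<in> Form L s. \<forall>e. is_assignment L \<AA> e \<longrightarrow> interp L \<AA> e s \<phi> = bone \<AA> s}"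


section \<open>The Lindenbaum-Tarski algebra\<close>

definition lt_rel ::
  "('s, 'o, 'p) lang \<Rightarrow> ('s \<Rightarrow> ('o, 'p) fm set) \<Rightarrow> 's \<Rightarrow> (('o, 'p) fm \<times> ('o, 'p) fm) set" where
  "lt_rel L \<Lambda> s = {(\<phi>, \<psi>). \<phi> \<in> Form L s \<and> \<psi> \<in> Form L s \<and> provable L \<Lambda> s (Iff \<phi> \<psi>)}"

definition lt_class ::
  "('s, 'o, 'p) lang \<Rightarrow> ('s \<Rightarrow> ('o, 'p) fm set) \<Rightarrow> 's \<Rightarrow> ('o, 'p) fm \<Rightarrow> ('o, 'p) fm set" where
  "lt_class L \<Lambda> s \<phi> = lt_rel L \<Lambda> s `` {\<phi>}"

text \<open>Operations on classes are given as unions over all choices of representatives.\<close>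

definition lindenbaum_tarski ::
  "('s, 'o, 'p) lang \<Rightarrow> ('s \<Rightarrow> ('o, 'p) fm set) \<Rightarrow> ('s, 'o, ('o, 'p) fm set) bao" where
  "lindenbaum_tarski L \<Lambda> = \<lparr>
     car = (\<lambda>s. Form L s // lt_rel L \<Lambda> s),
     bjoin = (\<lambda>s X Y. \<Union>\<phi> \<in> X. \<Union>\<psi> \<in> Y. lt_class L \<Lambda> s (Or \<phi> \<psi>)),
     bneg = (\<lambda>s X. \<Union>\<phi> \<in> X. lt_class L \<Lambda> s (Neg \<phi>)),
     bzero = (\<lambda>s. lt_class L \<Lambda> s (Bot L s)),
     opn = (\<lambda>\<sigma> Xs. \<Union>\<phi>s \<in> listset Xs. lt_class L \<Lambda> (result L \<sigma>) (Op \<sigma> \<phi>s))\<rparr>"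

lemma lt_class_in_car:
  "\<phi> \<in> Form L s \<Longrightarrow> lt_class L \<Lambda> s \<phi> \<in> car (lindenbaum_tarski L \<Lambda>) s"
  by (simp add: lindenbaum_tarski_def lt_class_def quotientI)

end

theory Submission
  imports Defs
begin

text \<open>Soundness is an induction on proofs. For completeness, an assignment in the
  Lindenbaum-Tarski algebra amounts to choosing representatives, that is, a sort-preserving
  substitution \<open>\<theta>\<close>, and it sends \<open>\<phi>\<close> to the class of \<open>\<phi>\<theta>\<close>. Since the axioms are closed under
  substitution, the algebra validates the logic, and the assignment \<open>p \<mapsto> [p]\<close> refutes every
  formula that is not provable.\<close>

section \<open>Formulas, truth tables and substitution\<close>

lemmas conn_defs = Top_def Bot_def Iff_def And_def Imp_def

lemma truth_conn [simp]:
  "truth v (And \<phi> \<psi>) \<longleftrightarrow> truth v \<phi> \<and> truth v \<psi>"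
  "truth v (Imp \<phi> \<psi>) \<longleftrightarrow> (truth v \<phi> \<longrightarrow> truth v \<psi>)"
  "truth v (Iff \<phi> \<psi>) \<longleftrightarrow> (truth v \<phi> \<longleftrightarrow> truth v \<psi>)"
  "\<not> truth v (Bot L s)" "truth v (Top L s)"
  "truth v (Box \<sigma> \<phi>s) \<longleftrightarrow> \<not> v (Op \<sigma> (map Neg \<phi>s))"
  by (auto simp: conn_defs Box_def)

lemma subst_conn [simp]:
  "subst \<theta> (And \<phi> \<psi>) = And (subst \<theta> \<phi>) (subst \<theta> \<psi>)"
  "subst \<theta> (Imp \<phi> \<psi>) = Imp (subst \<theta> \<phi>) (subst \<theta> \<psi>)"
  "subst \<theta> (Iff \<phi> \<psi>) = Iff (subst \<theta> \<phi>) (subst \<theta> \<psi>)"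
  "subst \<theta> (Box \<sigma> \<phi>s) = Box \<sigma> (map (subst \<theta>) \<phi>s)"
  by (simp_all add: conn_defs Box_def)

text \<open>Evaluating an instance amounts to giving each atom, a variable or an operator formula,
  the value of its own instance. Tautologies are therefore closed under substitution.\<close>

lemma truth_subst: "truth v (subst \<theta> \<phi>) = truth (\<lambda>\<alpha>. truth v (subst \<theta> \<alpha>)) \<phi>"
  by (induction \<phi>) auto

lemma subst_subst: "subst \<eta> (subst \<theta> \<phi>) = subst (\<lambda>p. subst \<eta> (\<theta> p)) \<phi>"
  by (induction \<phi>) auto

abbreviation Forms :: "('s, 'o, 'p) lang \<Rightarrow> 's list \<Rightarrow> ('o, 'p) fm list \<Rightarrow> bool" where
  "Forms L \<equiv> list_all2 (\<lambda>t \<psi>. \<psi> \<in> Form L t)"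

lemma Form_Neg [simp]: "Neg \<phi> \<in> Form L s \<longleftrightarrow> \<phi> \<in> Form L s"
  by (auto simp: Form_def intro: is_form.intros elim: is_form.cases)

lemma Form_Or [simp]: "Or \<phi> \<psi> \<in> Form L s \<longleftrightarrow> \<phi> \<in> Form L s \<and> \<psi> \<in> Form L s"
  by (auto simp: Form_def intro: is_form.intros elim: is_form.cases)

lemma Form_Var [simp]: "Var p \<in> Form L s \<longleftrightarrow> s \<in> Sorts L \<and> p \<in> Vars L s"
  by (auto simp: Form_def intro: is_form.intros elim: is_form.cases)

lemma Form_Op [simp]:
  "Op \<sigma> \<phi>s \<in> Form L s \<longleftrightarrow> s = result L \<sigma> \<and> \<sigma> \<in> Ops L \<and> Forms L (arity L \<sigma>) \<phi>s"
  by (auto simp: Form_def intro: is_form.intros elim: is_form.cases)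

lemma Form_conn [simp]:
  "And \<phi> \<psi> \<in> Form L s \<longleftrightarrow> \<phi> \<in> Form L s \<and> \<psi> \<in> Form L s"
  "Imp \<phi> \<psi> \<in> Form L s \<longleftrightarrow> \<phi> \<in> Form L s \<and> \<psi> \<in> Form L s"
  "Iff \<phi> \<psi> \<in> Form L s \<longleftrightarrow> \<phi> \<in> Form L s \<and> \<psi> \<in> Form L s"
  by (auto simp: And_def Imp_def Iff_def)

lemma Forms_map_Neg [simp]: "Forms L ts (map Neg \<psi>s) \<longleftrightarrow> Forms L ts \<psi>s"
  by (auto simp: list_all2_conv_all_nth)

lemma Form_Box [simp]:
  "Box \<sigma> \<phi>s \<in> Form L s \<longleftrightarrow> s = result L \<sigma> \<and> \<sigma> \<in> Ops L \<and> Forms L (arity L \<sigma>) \<phi>s"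
  by (simp add: Box_def)

lemma list_all2_update:
  "list_all2 P xs ys \<Longrightarrow> i < length xs \<Longrightarrow> P (xs ! i) y \<Longrightarrow> list_all2 P xs (ys[i := y])"
  by (auto simp: list_all2_conv_all_nth nth_list_update)

text \<open>The induction of \<open>is_form\<close> in terms of \<open>Form\<close>, with the sorts
  of the subformulas kept beside the induction hypotheses.\<close>

lemma Form_induct [consumes 1, case_names Var Neg Or Op]:
  assumes "\<phi> \<in> Form L s"
    and "\<And>s p. s \<in> Sorts L \<Longrightarrow> p \<in> Vars L s \<Longrightarrow> P s (Var p)"
    and "\<And>s \<phi>. \<phi> \<in> Form L s \<Longrightarrow> P s \<phi> \<Longrightarrow> P s (Neg \<phi>)"
    and "\<And>s \<phi> \<psi>. \<phi> \<in> Form L s \<Longrightarrow> P s \<phi> \<Longrightarrow> \<psi> \<in> Form L s \<Longrightarrow> P s \<psi> \<Longrightarrow> P s (Or \<phi> \<psi>)"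
    and "\<And>\<sigma> \<phi>s. \<sigma> \<in> Ops L \<Longrightarrow> Forms L (arity L \<sigma>) \<phi>s \<Longrightarrow> list_all2 P (arity L \<sigma>) \<phi>s \<Longrightarrow>
      P (result L \<sigma>) (Op \<sigma> \<phi>s)"
  shows "P s \<phi>"
proof -
  have "is_form L s \<phi>" using assms(1) by (simp add: Form_def)
  then show ?thesis
    by (induction rule: is_form.induct)
      (use assms(2-) in \<open>auto simp: Form_def list_all2_conv_all_nth\<close>)
qed

lemma Form_subst:
  assumes "sort_preserving L \<theta>" "\<phi> \<in> Form L s"
  shows "subst \<theta> \<phi> \<in> Form L s"
  using assms(2) by (induction rule: Form_induct)
    (use assms(1) in \<open>auto simp: sort_preserving_def list_all2_conv_all_nth\<close>)

lemma Forms_subst: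
  "sort_preserving L \<theta> \<Longrightarrow> Forms L ts \<phi>s \<Longrightarrow> Forms L ts (map (subst \<theta>) \<phi>s)"
  by (simp add: list_all2_conv_all_nth Form_subst)

text \<open>Substitution commutes with the connectives, with \<open>Box\<close> and with list
  update, so an instance of a modal axiom falls under the same schema. Tautologies stay tautologies
  by \<open>truth_subst\<close>.\<close>

lemma K_axiom_subst:
  assumes "K_axiom L s \<phi>" and \<theta>: "sort_preserving L \<theta>"
  shows "K_axiom L s (subst \<theta> \<phi>)"
  using assms(1)
proof cases
  case classical
  then have "truth v (subst \<theta> \<phi>)" for v
    by (subst truth_subst) (simp add: classical_theorem_def)
  with classical show ?thesis
    by (intro K_axiom.classical Form_subst[OF \<theta>]) (simp_all add: classical_theorem_def)
next
  case (normality \<sigma> i \<psi>s \<phi> \<chi>)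
  then show ?thesis
    using K_axiom.normality[of \<sigma> L i "map (subst \<theta>) \<psi>s" "subst \<theta> \<phi>" "subst \<theta> \<chi>"]
    by (simp add: Form_subst[OF \<theta>] Forms_subst[OF \<theta>] map_update)
next
  case (duality \<sigma> \<psi>s)
  then show ?thesis
    using K_axiom.duality[of \<sigma> L "map (subst \<theta>) \<psi>s"]
    by (simp add: Forms_subst[OF \<theta>] comp_def)
qed

text \<open>For the formulas that stem from \<open>\<Lambda>\<close>, an instance of an instance is
  an instance under the composed substitution.\<close>

lemma K_subst:
  assumes "\<phi> \<in> K L \<Lambda> s" and \<theta>: "sort_preserving L \<theta>"
  shows "subst \<theta> \<phi> \<in> K L \<Lambda> s"
proof -
  have "subst \<theta> (subst \<eta> \<psi>) \<in> K L \<Lambda> s" if "sort_preserving L \<eta>" "\<psi> \<in> \<Lambda> s" for \<eta> \<psi>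
  proof -
    have "sort_preserving L (\<lambda>p. subst \<theta> (\<eta> p))"
      using that(1) Form_subst[OF \<theta>] by (auto simp: sort_preserving_def)
    then show ?thesis
      using that(2) by (auto simp: K_def subst_subst)
  qed
  then show ?thesis
    using assms K_axiom_subst[OF _ \<theta>] by (auto simp: K_def)
qed

section \<open>Auxiliary facts on lists, unions and Boolean algebras\<close>

lemma in_listset_iff: "xs \<in> listset As \<longleftrightarrow> list_all2 (\<in>) xs As"
  by (induction As arbitrary: xs) (auto simp: set_Cons_def list_all2_Cons2)

text \<open>This is how well-definedness on classes enters: a union over all representatives
  collapses once every choice gives the same class.\<close>

lemma UN_eq_const: "x \<in> A \<Longrightarrow> (\<And>y. y \<in> A \<Longrightarrow> f y = c) \<Longrightarrow> (\<Union>y\<in>A. f y) = c"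
  by auto

lemma map2_update_right:
  "(map2 f xs ys)[i := f (xs ! i) y] = map2 f xs (ys[i := y])"
  using zip_update[of xs i "xs ! i" ys y] by (simp add: map_update)

text \<open>Double negation is not among the Boolean axioms, so the case that soundness needs is
  derived from the unit, complement and commutativity laws.\<close>

lemma boolean_algebra_neg_one:
  assumes "boolean_algebra_on A join neg zero"
  shows "neg (neg zero) = zero"
proof -
  let ?z = "neg (neg zero)"
  have "?z \<in> A" "neg ?z \<in> A"
    using assms by (auto simp: boolean_algebra_on_def Let_def)
  then have "join ?z (neg ?z) = join (neg ?z) ?z"
    using assms by (simp add: boolean_algebra_on_def Let_def)
  \<comment> \<open>With 1 for \<open>neg zero\<close> and the meet written out, these are the law
    that x meet 1 is x, at \<open>?z\<close>, and the law that x meet its complement is 0, at 1.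
    Commutativity of \<open>join\<close> makes their left sides equal.\<close>
  moreover have "neg (join (neg ?z) ?z) = ?z" "neg (join ?z (neg ?z)) = zero"
    using assms by (auto simp: boolean_algebra_on_def Let_def)
  ultimately show ?thesis
    by simp
qed

lemma boolean_algebra_zero_join:
  assumes "boolean_algebra_on A join neg zero" "x \<in> A"
  shows "join zero x = x"
proof -
  have "join zero x = join x zero" "join x zero = x"
    using assms by (simp_all add: boolean_algebra_on_def Let_def)
  then show ?thesis by simp
qed

section \<open>Derived rules\<close>

locale sorted_logic =
  fixes L :: "('s, 'o, 'p) lang" and \<Lambda> :: "'s \<Rightarrow> ('o, 'p) fm set"
  assumes lang: "many_sorted_lang L"
    and axioms_Form: "t \<in> Sorts L \<Longrightarrow> \<Lambda> t \<subseteq> Form L t"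
begin

lemma result_Sorts: "\<sigma> \<in> Ops L \<Longrightarrow> result L \<sigma> \<in> Sorts L"
  using lang by (auto simp: many_sorted_lang_def)

lemma arity_Sorts: "\<sigma> \<in> Ops L \<Longrightarrow> i < length (arity L \<sigma>) \<Longrightarrow> arity L \<sigma> ! i \<in> Sorts L"
  using lang by (force simp: many_sorted_lang_def)

lemma Form_Sorts: "\<phi> \<in> Form L s \<Longrightarrow> s \<in> Sorts L"
  by (induction rule: Form_induct) (auto simp: result_Sorts)

lemma Form_Bot [simp]: "Bot L s \<in> Form L s \<longleftrightarrow> s \<in> Sorts L"
  using lang by (auto simp: Bot_def many_sorted_lang_def)

lemma Form_Top [simp]: "Top L s \<in> Form L s \<longleftrightarrow> s \<in> Sorts L"
  by (simp add: Top_def)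

lemma K_axiom_Form: "K_axiom L s \<phi> \<Longrightarrow> \<phi> \<in> Form L s"
  by (induction rule: K_axiom.induct) (auto simp: list_all2_update)

lemma K_Form: "s \<in> Sorts L \<Longrightarrow> \<phi> \<in> K L \<Lambda> s \<Longrightarrow> \<phi> \<in> Form L s"
  using axioms_Form by (auto simp: K_def K_axiom_Form Form_subst subset_iff)

lemma provable_Form: "provable L \<Lambda> s \<phi> \<Longrightarrow> \<phi> \<in> Form L s"
  by (induction rule: provable.induct) (auto simp: K_Form list_all2_update)

section \<open>Propositional reasoning inside the logic\<close>

lemma provable_axiom: "K_axiom L s \<phi> \<Longrightarrow> provable L \<Lambda> s \<phi>"
  by (rule provable.ax) (auto simp: K_def dest: K_axiom_Form Form_Sorts)

lemma provable_classical: "\<phi> \<in> Form L s \<Longrightarrow> (\<And>v. truth v \<phi>) \<Longrightarrow> provable L \<Lambda> s \<phi>"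
  by (intro provable_axiom K_axiom.classical) (auto simp: classical_theorem_def)

text \<open>\<open>Imp \<alpha> \<phi>\<close> is a tautology, so one modus ponens suffices. The
  versions with more premises first derive the implication from the last premise to
  \<open>\<phi>\<close>. Thus purely propositional steps are settled by truth tables.\<close>

lemma provable_consequence:
  assumes "provable L \<Lambda> s \<alpha>" "\<phi> \<in> Form L s" "\<And>v. truth v \<alpha> \<Longrightarrow> truth v \<phi>"
  shows "provable L \<Lambda> s \<phi>"
  by (rule provable.mp[OF assms(1) provable_classical])
    (use assms provable_Form[OF assms(1)] in auto)

lemma provable_consequence2:
  assumes "provable L \<Lambda> s \<alpha>" "provable L \<Lambda> s \<beta>" "\<phi> \<in> Form L s"
    "\<And>v. truth v \<alpha> \<Longrightarrow> truth v \<beta> \<Longrightarrow> truth v \<phi>"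
  shows "provable L \<Lambda> s \<phi>"
  by (rule provable.mp[OF assms(2) provable_consequence[OF assms(1)]])
    (use assms provable_Form[OF assms(2)] in auto)

lemma provable_consequence3:
  assumes "provable L \<Lambda> s \<alpha>" "provable L \<Lambda> s \<beta>" "provable L \<Lambda> s \<gamma>" "\<phi> \<in> Form L s"
    "\<And>v. truth v \<alpha> \<Longrightarrow> truth v \<beta> \<Longrightarrow> truth v \<gamma> \<Longrightarrow> truth v \<phi>"
  shows "provable L \<Lambda> s \<phi>"
  by (rule provable.mp[OF assms(3) provable_consequence2[OF assms(1,2)]])
    (use assms provable_Form[OF assms(3)] in auto)

lemma provable_consequence4:
  assumes "provable L \<Lambda> s \<alpha>" "provable L \<Lambda> s \<beta>" "provable L \<Lambda> s \<gamma>" "provable L \<Lambda> s \<delta>"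
    "\<phi> \<in> Form L s"
    "\<And>v. truth v \<alpha> \<Longrightarrow> truth v \<beta> \<Longrightarrow> truth v \<gamma> \<Longrightarrow> truth v \<delta> \<Longrightarrow> truth v \<phi>"
  shows "provable L \<Lambda> s \<phi>"
  by (rule provable.mp[OF assms(4) provable_consequence3[OF assms(1-3)]])
    (use assms provable_Form[OF assms(4)] in auto)

lemma provable_Iff_sym: "provable L \<Lambda> s (Iff \<phi> \<psi>) \<Longrightarrow> provable L \<Lambda> s (Iff \<psi> \<phi>)"
  by (frule provable_Form, erule provable_consequence) auto

lemma provable_Iff_trans:
  assumes "provable L \<Lambda> s (Iff \<phi> \<psi>)" "provable L \<Lambda> s (Iff \<psi> \<chi>)"
  shows "provable L \<Lambda> s (Iff \<phi> \<chi>)"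
  by (rule provable_consequence2[OF assms]) (use assms[THEN provable_Form] in auto)

section \<open>Operators in a single argument place\<close>

context
  fixes \<sigma> i \<psi>s
  assumes \<sigma>: "\<sigma> \<in> Ops L" and i: "i < length (arity L \<sigma>)" and \<psi>s: "Forms L (arity L \<sigma>) \<psi>s"
begin

lemma Op_update_Form:
  "\<phi> \<in> Form L (arity L \<sigma> ! i) \<Longrightarrow> Op \<sigma> (\<psi>s[i := \<phi>]) \<in> Form L (result L \<sigma>)"
  using \<sigma> i \<psi>s by (simp add: list_all2_update)

lemma Box_update_Form:
  "\<phi> \<in> Form L (arity L \<sigma> ! i) \<Longrightarrow> Box \<sigma> ((map Neg \<psi>s)[i := \<phi>]) \<in> Form L (result L \<sigma>)"
  using \<sigma> i \<psi>s by (simp add: list_all2_update)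

text \<open>The duality axiom negates every argument, including the one at position
  \<open>i\<close>. This is why the boxes of this part carry the side arguments
  \<open>map Neg \<psi>s\<close>.\<close>

lemma provable_dual:
  assumes "\<phi> \<in> Form L (arity L \<sigma> ! i)"
  shows "provable L \<Lambda> (result L \<sigma>)
    (Iff (Op \<sigma> (\<psi>s[i := \<phi>])) (Neg (Box \<sigma> ((map Neg \<psi>s)[i := Neg \<phi>]))))"
  using provable_axiom[OF K_axiom.duality[of \<sigma> L "\<psi>s[i := \<phi>]"]] \<sigma> i \<psi>s assms
  by (force simp: list_all2_update map_update)

lemma provable_Box_mp:
  assumes "\<phi> \<in> Form L (arity L \<sigma> ! i)" "\<chi> \<in> Form L (arity L \<sigma> ! i)"
  shows "provable L \<Lambda> (result L \<sigma>)
    (Imp (Box \<sigma> ((map Neg \<psi>s)[i := Imp \<phi> \<chi>]))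
      (Imp (Box \<sigma> ((map Neg \<psi>s)[i := \<phi>])) (Box \<sigma> ((map Neg \<psi>s)[i := \<chi>]))))"
  using \<sigma> i \<psi>s assms by (intro provable_axiom K_axiom.normality) auto

lemma provable_Box:
  "provable L \<Lambda> (arity L \<sigma> ! i) \<phi> \<Longrightarrow>
    provable L \<Lambda> (result L \<sigma>) (Box \<sigma> ((map Neg \<psi>s)[i := \<phi>]))"
  using \<sigma> i \<psi>s by (intro provable.ug) auto

text \<open>Contraposing, generalizing and distributing the box gives an implication from the box of
  \<open>Neg \<chi>\<close> to that of \<open>Neg \<phi>\<close>. Duality turns it into monotonicity
  of \<open>\<sigma>\<close>.\<close>

lemma provable_Op_mono:
  assumes "provable L \<Lambda> (arity L \<sigma> ! i) (Imp \<phi> \<chi>)"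
  shows "provable L \<Lambda> (result L \<sigma>) (Imp (Op \<sigma> (\<psi>s[i := \<phi>])) (Op \<sigma> (\<psi>s[i := \<chi>])))"
proof -
  have F: "\<phi> \<in> Form L (arity L \<sigma> ! i)" "\<chi> \<in> Form L (arity L \<sigma> ! i)"
    using provable_Form[OF assms] by auto
  have "provable L \<Lambda> (arity L \<sigma> ! i) (Imp (Neg \<chi>) (Neg \<phi>))"
    by (rule provable_consequence[OF assms]) (use F in auto)
  from provable_Box[OF this] provable_Box_mp[of "Neg \<chi>" "Neg \<phi>"]
    provable_dual[OF F(1)] provable_dual[OF F(2)]
  show ?thesis
    by (rule provable_consequence4)
      \<comment> \<open>Boxes and operator formulas stay unexpanded, so that they act as
        propositional atoms shared by the four premises.\<close>
      (use F Op_update_Form in \<open>auto simp del: Form_Op truth.simps(4) truth_conn(6)\<close>)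
qed

lemma provable_Op_cong1:
  assumes "provable L \<Lambda> (arity L \<sigma> ! i) (Iff \<phi> \<chi>)"
  shows "provable L \<Lambda> (result L \<sigma>) (Iff (Op \<sigma> (\<psi>s[i := \<phi>])) (Op \<sigma> (\<psi>s[i := \<chi>])))"
proof -
  have F: "\<phi> \<in> Form L (arity L \<sigma> ! i)" "\<chi> \<in> Form L (arity L \<sigma> ! i)"
    using provable_Form[OF assms] by auto
  have "provable L \<Lambda> (arity L \<sigma> ! i) (Imp \<phi> \<chi>)" "provable L \<Lambda> (arity L \<sigma> ! i) (Imp \<chi> \<phi>)"
    by (rule provable_consequence[OF assms]; use F in auto)+
  from this[THEN provable_Op_mono] show ?thesis
    by (rule provable_consequence2) (use F Op_update_Form in auto)
qed

text \<open>The negated falsum is a tautology; by generalization its box is provable, and by duality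
  this refutes \<open>\<sigma>\<close> at the falsum.\<close>

lemma provable_Op_Bot:
  "provable L \<Lambda> (result L \<sigma>) (Iff (Op \<sigma> (\<psi>s[i := Bot L (arity L \<sigma> ! i)])) (Bot L (result L \<sigma>)))"
proof -
  have F: "Bot L (arity L \<sigma> ! i) \<in> Form L (arity L \<sigma> ! i)"
    using arity_Sorts[OF \<sigma> i] by simp
  then have "provable L \<Lambda> (arity L \<sigma> ! i) (Neg (Bot L (arity L \<sigma> ! i)))"
    by (intro provable_classical) auto
  from provable_Box[OF this] provable_dual[OF F] show ?thesis
    by (rule provable_consequence2) (use Op_update_Form[OF F] result_Sorts[OF \<sigma>] in auto)
qed

text \<open>For the forward half, a propositional tautology is boxed and distributed twice, so that
  the boxes of \<open>Neg \<phi>\<close> and \<open>Neg \<chi>\<close> yield that of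
  \<open>Neg (Or \<phi> \<chi>)\<close>; duality and contraposition finish it. The converse is
  monotonicity.\<close>

lemma provable_Op_Or:
  assumes F: "\<phi> \<in> Form L (arity L \<sigma> ! i)" "\<chi> \<in> Form L (arity L \<sigma> ! i)"
  shows "provable L \<Lambda> (result L \<sigma>)
    (Iff (Op \<sigma> (\<psi>s[i := Or \<phi> \<chi>])) (Or (Op \<sigma> (\<psi>s[i := \<phi>])) (Op \<sigma> (\<psi>s[i := \<chi>]))))"
proof -
  let ?B = "\<lambda>\<alpha>. Box \<sigma> ((map Neg \<psi>s)[i := \<alpha>])" and ?O = "\<lambda>\<alpha>. Op \<sigma> (\<psi>s[i := \<alpha>])"
  let ?\<alpha> = "Neg (Or \<phi> \<chi>)"
  have "provable L \<Lambda> (arity L \<sigma> ! i) (Imp (Neg \<phi>) (Imp (Neg \<chi>) ?\<alpha>))"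
    by (rule provable_classical) (use F in auto)
  from provable_Box[OF this] provable_Box_mp[of "Neg \<phi>" "Imp (Neg \<chi>) ?\<alpha>"]
    provable_Box_mp[of "Neg \<chi>" ?\<alpha>]
  have "provable L \<Lambda> (result L \<sigma>) (Imp (?B (Neg \<phi>)) (Imp (?B (Neg \<chi>)) (?B ?\<alpha>)))"
    by (rule provable_consequence3)
      (use F Box_update_Form in \<open>auto simp del: Form_Box truth_conn(6)\<close>)
  from this provable_dual[OF F(1)] provable_dual[OF F(2)] provable_dual[of "Or \<phi> \<chi>"]
  have le: "provable L \<Lambda> (result L \<sigma>) (Imp (?O (Or \<phi> \<chi>)) (Or (?O \<phi>) (?O \<chi>)))"
    by (rule provable_consequence4)
      (use F Op_update_Form in \<open>auto simp del: Form_Op truth.simps(4) truth_conn(6)\<close>)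
  have "provable L \<Lambda> (arity L \<sigma> ! i) (Imp \<phi> (Or \<phi> \<chi>))"
    "provable L \<Lambda> (arity L \<sigma> ! i) (Imp \<chi> (Or \<phi> \<chi>))"
    by (rule provable_classical; use F in auto)+
  from le this[THEN provable_Op_mono] show ?thesis
    by (rule provable_consequence3)
      (use F Op_update_Form in \<open>auto simp del: Form_Op truth.simps(4)\<close>)
qed

end

text \<open>The arguments are exchanged one at a time from the left. After \<open>k\<close>
  exchanges the list is \<open>take k \<psi>s @ drop k \<phi>s\<close>, and transitivity chains the
  exchanges.\<close>

lemma provable_Op_cong:
  assumes \<sigma>: "\<sigma> \<in> Ops L" and \<phi>s: "Forms L (arity L \<sigma>) \<phi>s" and \<psi>s: "Forms L (arity L \<sigma>) \<psi>s"
    and eq: "\<And>i. i < length (arity L \<sigma>) \<Longrightarrow>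
      provable L \<Lambda> (arity L \<sigma> ! i) (Iff (\<phi>s ! i) (\<psi>s ! i))"
  shows "provable L \<Lambda> (result L \<sigma>) (Iff (Op \<sigma> \<phi>s) (Op \<sigma> \<psi>s))"
proof -
  let ?n = "length (arity L \<sigma>)"
  have len: "length \<phi>s = ?n" "length \<psi>s = ?n"
    using \<phi>s \<psi>s by (simp_all add: list_all2_conv_all_nth)
  have "provable L \<Lambda> (result L \<sigma>) (Iff (Op \<sigma> \<phi>s) (Op \<sigma> (take k \<psi>s @ drop k \<phi>s)))"
    if "k \<le> ?n" for k
    using that
  proof (induction k)
    case 0
    show ?case
      by (rule provable_classical) (use \<sigma> \<phi>s in auto)
  next
    case (Suc k)
    let ?\<chi>s = "take k \<psi>s @ drop k \<phi>s"
    have k: "k < ?n" using Suc.prems by simp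
    have "Forms L (arity L \<sigma>) ?\<chi>s"
      using \<phi>s \<psi>s k by (auto simp: list_all2_conv_all_nth nth_append)
    from provable_Op_cong1[OF \<sigma> k this eq[OF k]]
    have "provable L \<Lambda> (result L \<sigma>)
      (Iff (Op \<sigma> (?\<chi>s[k := \<phi>s ! k])) (Op \<sigma> (?\<chi>s[k := \<psi>s ! k])))" .
    \<comment> \<open>Position \<open>k\<close> still holds \<open>\<phi>s ! k\<close>; writing it
      back presents the list as an update, the form that \<open>provable_Op_cong1\<close> speaks
      about.\<close>
    moreover have "?\<chi>s[k := \<phi>s ! k] = ?\<chi>s"
      using k len by (intro list_update_same_conv[THEN iffD2]) (auto simp: nth_append)
    moreover have "?\<chi>s[k := \<psi>s ! k] = take (Suc k) \<psi>s @ drop (Suc k) \<phi>s"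
      using k len by (intro nth_equalityI) (auto simp: nth_append nth_list_update less_Suc_eq)
    ultimately show ?case
      using Suc.IH k by (auto intro: provable_Iff_trans)
  qed
  from this[of ?n] show ?thesis using len by simp
qed

section \<open>The Lindenbaum-Tarski algebra\<close>

abbreviation LT :: "('s, 'o, ('o, 'p) fm set) bao" where
  "LT \<equiv> lindenbaum_tarski L \<Lambda>"

abbreviation cls :: "'s \<Rightarrow> ('o, 'p) fm \<Rightarrow> ('o, 'p) fm set" where
  "cls \<equiv> lt_class L \<Lambda>"

lemma in_cls_iff:
  "\<phi> \<in> Form L s \<Longrightarrow> \<psi> \<in> cls s \<phi> \<longleftrightarrow> \<psi> \<in> Form L s \<and> provable L \<Lambda> s (Iff \<phi> \<psi>)"
  by (auto simp: lt_class_def lt_rel_def)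

lemma cls_self: "\<phi> \<in> Form L s \<Longrightarrow> \<phi> \<in> cls s \<phi>"
  by (auto simp: in_cls_iff intro: provable_classical)

lemma cls_eq_iff:
  assumes "\<phi> \<in> Form L s" "\<psi> \<in> Form L s"
  shows "cls s \<phi> = cls s \<psi> \<longleftrightarrow> provable L \<Lambda> s (Iff \<phi> \<psi>)"
proof
  assume "cls s \<phi> = cls s \<psi>"
  then show "provable L \<Lambda> s (Iff \<phi> \<psi>)"
    using cls_self[OF assms(2)] assms(1) by (auto simp: in_cls_iff)
next
  assume eq: "provable L \<Lambda> s (Iff \<phi> \<psi>)"
  show "cls s \<phi> = cls s \<psi>"
    using assms provable_Iff_trans[OF eq] provable_Iff_trans[OF provable_Iff_sym[OF eq]]
    by (auto simp: in_cls_iff)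
qed

text \<open>A formula and its equivalence with the verum are tautological consequences of each
  other.\<close>

lemma cls_eq_Top_iff:
  assumes "\<phi> \<in> Form L s"
  shows "cls s \<phi> = cls s (Top L s) \<longleftrightarrow> provable L \<Lambda> s \<phi>"
  using assms Form_Sorts[OF assms]
  by (auto simp: cls_eq_iff elim!: provable_consequence)

lemma car_LT: "car LT s = cls s ` Form L s"
  by (auto simp: lindenbaum_tarski_def quotient_def lt_class_def)

lemma bzero_LT: "bzero LT s = cls s (Bot L s)"
  by (simp add: lindenbaum_tarski_def)

text \<open>Equivalent formulas have equivalent negations, so all classes in the defining union
  coincide and one representative determines the value.\<close>

lemma bneg_LT:
  assumes "\<phi> \<in> Form L s"
  shows "bneg LT s (cls s \<phi>) = cls s (Neg \<phi>)"
proof -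
  have "cls s (Neg \<psi>) = cls s (Neg \<phi>)" if "\<psi> \<in> cls s \<phi>" for \<psi>
    using that assms by (auto simp: in_cls_iff cls_eq_iff elim!: provable_consequence)
  with cls_self[OF assms] have "(\<Union>\<psi>\<in>cls s \<phi>. cls s (Neg \<psi>)) = cls s (Neg \<phi>)"
    by (rule UN_eq_const)
  then show ?thesis by (simp add: lindenbaum_tarski_def)
qed

lemma bjoin_LT:
  assumes "\<phi> \<in> Form L s" "\<psi> \<in> Form L s"
  shows "bjoin LT s (cls s \<phi>) (cls s \<psi>) = cls s (Or \<phi> \<psi>)"
proof -
  have "cls s (Or \<phi>' \<psi>') = cls s (Or \<phi> \<psi>)" if "\<phi>' \<in> cls s \<phi>" "\<psi>' \<in> cls s \<psi>" for \<phi>' \<psi>'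
  proof -
    have F: "\<phi>' \<in> Form L s" "\<psi>' \<in> Form L s"
      and "provable L \<Lambda> s (Iff \<phi> \<phi>')" "provable L \<Lambda> s (Iff \<psi> \<psi>')"
      using that assms by (simp_all add: in_cls_iff)
    from this(3,4) have "provable L \<Lambda> s (Iff (Or \<phi>' \<psi>') (Or \<phi> \<psi>))"
      by (rule provable_consequence2) (use F assms in auto)
    then show ?thesis
      using F assms by (simp add: cls_eq_iff)
  qed
  then have "(\<Union>\<phi>'\<in>cls s \<phi>. \<Union>\<psi>'\<in>cls s \<psi>. cls s (Or \<phi>' \<psi>')) = cls s (Or \<phi> \<psi>)"
    using assms[THEN cls_self] by (intro UN_eq_const)
  then show ?thesis by (simp add: lindenbaum_tarski_def)
qed

text \<open>\<open>listset\<close> picks a representative of each argument independently, so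
  congruence in all arguments at once is called for.\<close>

lemma opn_LT:
  assumes \<sigma>: "\<sigma> \<in> Ops L" and \<phi>s: "Forms L (arity L \<sigma>) \<phi>s"
  shows "opn LT \<sigma> (map2 cls (arity L \<sigma>) \<phi>s) = cls (result L \<sigma>) (Op \<sigma> \<phi>s)"
proof -
  have "cls (result L \<sigma>) (Op \<sigma> \<psi>s) = cls (result L \<sigma>) (Op \<sigma> \<phi>s)"
    if "\<psi>s \<in> listset (map2 cls (arity L \<sigma>) \<phi>s)" for \<psi>s
  proof -
    have *: "length \<psi>s = length (arity L \<sigma>)"
      "\<And>i. i < length (arity L \<sigma>) \<Longrightarrow> \<psi>s ! i \<in> cls (arity L \<sigma> ! i) (\<phi>s ! i)"
      "\<And>i. i < length (arity L \<sigma>) \<Longrightarrow> \<phi>s ! i \<in> Form L (arity L \<sigma> ! i)"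
      using that \<phi>s by (auto simp: in_listset_iff list_all2_conv_all_nth)
    then have \<psi>s: "Forms L (arity L \<sigma>) \<psi>s"
      by (auto simp: list_all2_conv_all_nth in_cls_iff)
    have "provable L \<Lambda> (result L \<sigma>) (Iff (Op \<sigma> \<phi>s) (Op \<sigma> \<psi>s))"
      by (rule provable_Op_cong[OF \<sigma> \<phi>s \<psi>s]) (use * in_cls_iff in blast)
    then show ?thesis
      using \<sigma> \<phi>s \<psi>s by (simp add: cls_eq_iff provable_Iff_sym)
  qed
  moreover have "\<phi>s \<in> listset (map2 cls (arity L \<sigma>) \<phi>s)"
    using \<phi>s by (auto simp: in_listset_iff list_all2_conv_all_nth cls_self)
  ultimately have "(\<Union>\<psi>s\<in>listset (map2 cls (arity L \<sigma>) \<phi>s). cls (result L \<sigma>) (Op \<sigma> \<psi>s)) =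
      cls (result L \<sigma>) (Op \<sigma> \<phi>s)"
    by (intro UN_eq_const)
  then show ?thesis by (simp add: lindenbaum_tarski_def)
qed

lemma bone_LT: "s \<in> Sorts L \<Longrightarrow> bone LT s = cls s (Top L s)"
  by (simp add: bone_def bzero_LT bneg_LT Top_def)

text \<open>On representatives, each Boolean law asserts that a certain equivalence is provable, and
  that equivalence is a tautology.\<close>

lemma boolean_algebra_LT:
  assumes "s \<in> Sorts L"
  shows "boolean_algebra_on (car LT s) (bjoin LT s) (bneg LT s) (bzero LT s)"
  unfolding boolean_algebra_on_def Let_def car_LT bzero_LT
  using assms by (auto simp: bneg_LT bjoin_LT cls_eq_iff intro!: provable_classical imageI)

lemma LT_args:
  assumes "list_all2 (\<lambda>t a. a \<in> car LT t) ts as"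
  obtains \<phi>s where "Forms L ts \<phi>s" "as = map2 cls ts \<phi>s"
proof -
  have "\<exists>\<phi>s. Forms L ts \<phi>s \<and> as = map2 cls ts \<phi>s"
    using assms
  proof (induction rule: list_all2_induct)
    case (Cons t ts a as)
    then obtain \<phi> \<phi>s where "\<phi> \<in> Form L t" "a = cls t \<phi>" "Forms L ts \<phi>s" "as = map2 cls ts \<phi>s"
      by (auto simp: car_LT)
    then show ?case by (intro exI[of _ "\<phi> # \<phi>s"]) simp
  qed simp
  then show ?thesis using that by blast
qed

text \<open>Once representatives are chosen, preservation of zero is \<open>provable_Op_Bot\<close>
  and additivity is \<open>provable_Op_Or\<close>.\<close>

lemma is_bao_LT: "is_bao L LT"
  unfolding is_bao_def
proof (intro conjI ballI allI impI)
  fix \<sigma> as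
  assume \<sigma>: "\<sigma> \<in> Ops L" and "list_all2 (\<lambda>t a. a \<in> car LT t) (arity L \<sigma>) as"
  then obtain \<phi>s where \<phi>s: "Forms L (arity L \<sigma>) \<phi>s" and as: "as = map2 cls (arity L \<sigma>) \<phi>s"
    using LT_args by metis
  show "opn LT \<sigma> as \<in> car LT (result L \<sigma>)"
    using \<sigma> \<phi>s by (auto simp: as opn_LT car_LT)
  fix i
  assume i: "i < length (arity L \<sigma>)"
  let ?t = "arity L \<sigma> ! i"
  have upd: "opn LT \<sigma> (as[i := cls ?t \<phi>]) = cls (result L \<sigma>) (Op \<sigma> (\<phi>s[i := \<phi>]))"
    if "\<phi> \<in> Form L ?t" for \<phi>
    using that by (simp add: as map2_update_right opn_LT[OF \<sigma>] list_all2_update[OF \<phi>s i])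
  note F = Op_update_Form[OF \<sigma> i \<phi>s]
  show "opn LT \<sigma> (as[i := bzero LT ?t]) = bzero LT (result L \<sigma>)"
    using provable_Op_Bot[OF \<sigma> i \<phi>s] arity_Sorts[OF \<sigma> i] result_Sorts[OF \<sigma>]
    by (simp add: bzero_LT upd cls_eq_iff F del: Form_Op)
  fix x y
  assume "x \<in> car LT ?t" "y \<in> car LT ?t"
  then obtain \<phi> \<psi> where "\<phi> \<in> Form L ?t" "x = cls ?t \<phi>" "\<psi> \<in> Form L ?t" "y = cls ?t \<psi>"
    by (auto simp: car_LT)
  then show "opn LT \<sigma> (as[i := bjoin LT ?t x y]) =
      bjoin LT (result L \<sigma>) (opn LT \<sigma> (as[i := x])) (opn LT \<sigma> (as[i := y]))"
    using provable_Op_Or[OF \<sigma> i \<phi>s]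
    by (simp add: bjoin_LT upd cls_eq_iff F del: Form_Op)
qed (rule boolean_algebra_LT)

text \<open>Class operations compute on representatives. With \<open>\<theta>\<close> representing a
  given assignment this yields validity of the axioms; with \<open>Var\<close> for
  \<open>\<theta>\<close> it yields completeness.\<close>

lemma interp_LT:
  assumes \<theta>: "sort_preserving L \<theta>"
    and e: "\<And>s p. s \<in> Sorts L \<Longrightarrow> p \<in> Vars L s \<Longrightarrow> e s p = cls s (\<theta> p)"
    and "\<phi> \<in> Form L s"
  shows "interp L LT e s \<phi> = cls s (subst \<theta> \<phi>)"
  using assms(3)
proof (induction rule: Form_induct)
  case (Op \<sigma> \<phi>s)
  have "map2 (interp L LT e) (arity L \<sigma>) \<phi>s = map2 cls (arity L \<sigma>) (map (subst \<theta>) \<phi>s)"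
    using Op(3) by (intro nth_equalityI) (auto simp: list_all2_conv_all_nth)
  then show ?case
    using Op(1,2) by (simp add: opn_LT Forms_subst[OF \<theta>])
qed (use e in \<open>auto simp: bneg_LT bjoin_LT Form_subst[OF \<theta>]\<close>)

text \<open>Disjointness of the variable sets is what lets the representatives of the
  values \<open>e s p\<close> be merged into one substitution, which does not see sorts.\<close>

lemma LT_assignment_representatives:
  assumes "is_assignment L LT e"
  obtains \<theta> where "sort_preserving L \<theta>"
    "\<And>s p. s \<in> Sorts L \<Longrightarrow> p \<in> Vars L s \<Longrightarrow> e s p = cls s (\<theta> p)"
proof -
  have "\<exists>\<phi>. \<forall>s\<in>Sorts L. p \<in> Vars L s \<longrightarrow> \<phi> \<in> Form L s \<and> e s p = cls s \<phi>" for p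
  proof (cases "\<exists>s\<in>Sorts L. p \<in> Vars L s")
    case True
    then obtain s where s: "s \<in> Sorts L" "p \<in> Vars L s" by blast
    then have "e s p \<in> cls s ` Form L s"
      using assms by (simp add: is_assignment_def car_LT)
    then obtain \<phi> where "\<phi> \<in> Form L s" "e s p = cls s \<phi>"
      by blast
    moreover have "t = s" if "t \<in> Sorts L" "p \<in> Vars L t" for t
      using lang s that unfolding many_sorted_lang_def by blast
    ultimately show ?thesis by blast
  \<comment> \<open>A variable of no sort is under no constraint, so any formula serves as its
    image.\<close>
  qed blast
  then obtain \<theta> where "\<And>p. \<forall>s\<in>Sorts L. p \<in> Vars L s \<longrightarrow> \<theta> p \<in> Form L s \<and> e s p = cls s (\<theta> p)"
    by metis
  then show ?thesis
    by (intro that[of \<theta>]) (auto simp: sort_preserving_def)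
qed

text \<open>If \<open>\<theta>\<close> represents the assignment, an axiom takes as value the class
  of its \<open>\<theta>\<close>-instance. That instance is again an axiom, hence provable, and its
  class is the top.\<close>

lemma K_subset_Taut_LT:
  assumes s: "s \<in> Sorts L"
  shows "K L \<Lambda> s \<subseteq> Taut L LT s"
proof
  fix \<phi>
  assume \<phi>: "\<phi> \<in> K L \<Lambda> s"
  have "interp L LT e s \<phi> = bone LT s" if e: "is_assignment L LT e" for e
  proof -
    obtain \<theta> where \<theta>: "sort_preserving L \<theta>"
      "\<And>s p. s \<in> Sorts L \<Longrightarrow> p \<in> Vars L s \<Longrightarrow> e s p = cls s (\<theta> p)"
      using LT_assignment_representatives[OF e] by metis
    have "provable L \<Lambda> s (subst \<theta> \<phi>)"
      using K_subst[OF \<phi> \<theta>(1)] s by (rule provable.ax[rotated])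
    then show ?thesis
      using interp_LT[OF \<theta> K_Form[OF s \<phi>]] cls_eq_Top_iff provable_Form
      by (simp add: bone_LT[OF s])
  qed
  then show "\<phi> \<in> Taut L LT s"
    using K_Form[OF s \<phi>] by (simp add: Taut_def)
qed

text \<open>The Lindenbaum-Tarski algebra has sets of formulas as elements, which fixes the type of
  the algebras quantified over. Under the canonical assignment \<open>\<phi>\<close> takes its own
  class as value, so validity puts it in the top class.\<close>

lemma completeness:
  assumes \<phi>: "\<phi> \<in> Form L s"
    and valid: "\<And>(\<AA> :: ('s, 'o, ('o, 'p) fm set) bao) e. is_bao L \<AA> \<Longrightarrow>
      \<forall>t\<in>Sorts L. K L \<Lambda> t \<subseteq> Taut L \<AA> t \<Longrightarrow> is_assignment L \<AA> e \<Longrightarrow>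
      interp L \<AA> e s \<phi> = bone \<AA> s"
  shows "provable L \<Lambda> s \<phi>"
proof -
  let ?e = "\<lambda>s p. cls s (Var p)"
  have "subst Var \<phi> = \<phi>"
    by (induction \<phi>) (auto simp: map_idI)
  moreover have "interp L LT ?e s \<phi> = cls s (subst Var \<phi>)"
    by (rule interp_LT) (auto simp: sort_preserving_def \<phi>)
  moreover have "interp L LT ?e s \<phi> = bone LT s"
    by (rule valid) (auto simp: is_bao_LT K_subset_Taut_LT[THEN subsetD] is_assignment_def car_LT)
  ultimately show ?thesis
    using cls_eq_Top_iff[OF \<phi>] by (simp add: bone_LT[OF Form_Sorts[OF \<phi>]])
qed

section \<open>Soundness\<close>

text \<open>Boolean laws are available on the carriers only, so soundness relies on values staying
  inside them.\<close>

lemma interp_in_car: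
  assumes \<AA>: "is_bao L \<AA>" and e: "is_assignment L \<AA> e" and "\<phi> \<in> Form L s"
  shows "interp L \<AA> e s \<phi> \<in> car \<AA> s"
  using assms(3)
proof (induction rule: Form_induct)
  case (Op \<sigma> \<phi>s)
  then have "list_all2 (\<lambda>t a. a \<in> car \<AA> t) (arity L \<sigma>) (map2 (interp L \<AA> e) (arity L \<sigma>) \<phi>s)"
    by (auto simp: list_all2_conv_all_nth)
  then show ?case
    using \<AA> Op(1) by (simp add: is_bao_def)
qed (use \<AA> e in \<open>auto simp: is_assignment_def is_bao_def boolean_algebra_on_def Let_def
  dest!: Form_Sorts\<close>)

text \<open>Axioms are valid by assumption, so only the two rules have content. The element type of
  \<open>\<AA>\<close> is arbitrary.\<close>

lemma soundness:
  assumes \<AA>: "is_bao L \<AA>" and K: "\<forall>t\<in>Sorts L. K L \<Lambda> t \<subseteq> Taut L \<AA> t"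
    and e: "is_assignment L \<AA> e" and "provable L \<Lambda> s \<phi>"
  shows "interp L \<AA> e s \<phi> = bone \<AA> s"
  using assms(4)
proof (induction rule: provable.induct)
  case (ax s \<phi>)
  then show ?case using K e by (auto simp: Taut_def)
next
  case (mp s \<phi> \<psi>)
  have \<psi>: "\<psi> \<in> Form L s" using provable_Form[OF mp(2)] by simp
  have B: "boolean_algebra_on (car \<AA> s) (bjoin \<AA> s) (bneg \<AA> s) (bzero \<AA> s)"
    using \<AA> Form_Sorts[OF \<psi>] by (simp add: is_bao_def)
  \<comment> \<open>Since \<open>\<phi>\<close> has value 1, its negation in
    \<open>Imp \<phi> \<psi>\<close> contributes zero to the join.\<close>
  have "bjoin \<AA> s (bzero \<AA> s) (interp L \<AA> e s \<psi>) = bone \<AA> s"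
    using mp.IH boolean_algebra_neg_one[OF B] by (simp add: Imp_def bone_def)
  then show ?case
    using boolean_algebra_zero_join[OF B interp_in_car[OF \<AA> e \<psi>]] by simp
next
  case (ug \<sigma> i \<psi>s \<phi>)
  let ?t = "arity L \<sigma> ! i" and ?as = "map2 (interp L \<AA> e) (arity L \<sigma>) (map Neg \<psi>s)"
  have B: "boolean_algebra_on (car \<AA> ?t) (bjoin \<AA> ?t) (bneg \<AA> ?t) (bzero \<AA> ?t)"
    using \<AA> arity_Sorts[OF ug(1,2)] by (simp add: is_bao_def)
  \<comment> \<open>The box negates its arguments, so a premise of value 1 enters the operator as
    zero. The operator then returns zero, and the outer negation of the box gives 1.\<close>
  have "interp L \<AA> e ?t (Neg \<phi>) = bzero \<AA> ?t"
    using ug.IH boolean_algebra_neg_one[OF B] by (simp add: bone_def)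
  then have upd: "map2 (interp L \<AA> e) (arity L \<sigma>) ((map Neg \<psi>s)[i := Neg \<phi>]) = ?as[i := bzero \<AA> ?t]"
    using map2_update_right[of "interp L \<AA> e" "arity L \<sigma>" "map Neg \<psi>s" i "Neg \<phi>"] by simp
  have "Forms L (arity L \<sigma>) (map Neg \<psi>s)" using ug(3) by simp
  then have "list_all2 (\<lambda>t a. a \<in> car \<AA> t) (arity L \<sigma>) ?as"
    by (auto simp: list_all2_conv_all_nth intro!: interp_in_car[OF \<AA> e, of "Neg _", simplified])
  then have "opn \<AA> \<sigma> (?as[i := bzero \<AA> ?t]) = bzero \<AA> (result L \<sigma>)"
    using \<AA> ug(1,2) by (simp add: is_bao_def)
  then show ?case
    using upd by (simp add: Box_def bone_def map_update)
qed

end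

text \<open>A HOL formula cannot quantify over types, so (iii) is split: the equivalence is stated
  at the element type of the Lindenbaum-Tarski algebra, and the implication from (i) also for
  algebras over an arbitrary type.\<close>

theorem mainTheorem3:
  fixes L :: "('s, 'o, 'p) lang"
    and \<Lambda> :: "'s \<Rightarrow> ('o, 'p) fm set"
    and s :: 's
    and \<phi> :: "('o, 'p) fm"
  assumes "many_sorted_lang L"
    and "\<forall>t \<in> Sorts L. \<Lambda> t \<subseteq> Form L t"
    and "s \<in> Sorts L"
    and "\<phi> \<in> Form L s"
  shows
    "(provable L \<Lambda> s \<phi> \<longleftrightarrow> lt_class L \<Lambda> s \<phi> = lt_class L \<Lambda> s (Top L s)) \<and>
     (provable L \<Lambda> s \<phi> \<longleftrightarrow>
       (\<forall>(\<AA> :: ('s, 'o, ('o, 'p) fm set) bao) e.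
          is_bao L \<AA> \<longrightarrow> (\<forall>t \<in> Sorts L. K L \<Lambda> t \<subseteq> Taut L \<AA> t) \<longrightarrow> is_assignment L \<AA> e \<longrightarrow>
          interp L \<AA> e s \<phi> = bone \<AA> s)) \<and>
     (provable L \<Lambda> s \<phi> \<longrightarrow>
       (\<forall>(\<AA> :: ('s, 'o, 'a) bao) e.
          is_bao L \<AA> \<longrightarrow> (\<forall>t \<in> Sorts L. K L \<Lambda> t \<subseteq> Taut L \<AA> t) \<longrightarrow> is_assignment L \<AA> e \<longrightarrow>
          interp L \<AA> e s \<phi> = bone \<AA> s))"
proof -
  interpret sorted_logic L \<Lambda>
    using assms(1,2) by unfold_locales auto
  show ?thesis
    using cls_eq_Top_iff[OF assms(4)] completeness[OF assms(4)]
    by (intro conjI allI impI iffI soundness; blast)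
qed

end
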